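(* Let $p>1$, $q\geq 1$, $r\in\mathbb{N}$ and $c>0$. Let $(a_n)_{n\ge 1}$ be a sequence of complex numbers belonging to the class $GM(p,{}_3\beta(q),r)$. Suppose that $$n\ln n\,|a_n|\to 0\quad\text{as } n\to\infty,$$ and that the series $$\sum_{k=1}^{\infty} a_k\cos\left(\frac{2l\pi}{r}k\right)$$ converges for all $l=0,1,\dots,[\frac r2]$. Then the series $$\sum_{n=1}^{\infty} a_n\cos(cnx)$$ is uniformly convergent (with respect to $x\in\mathbb{R}$).
   Context: $\mathbb{N}=\{1,2,3,\dots\}$ and $[x]$ denotes the integer part of $x$. For a sequence $(a_n)$ and $r\in\mathbb{N}$ put $\Delta_r a_n=a_n-a_{n+r}$. Definition of the class $GM(p,{}_3\beta(q),r)$, for real $p,q>0$ and $r\in\mathbb{N}$: a sequence $a=(a_n)_{n\ge1}$ of complex numbers with $a_n\to0$ belongs to $GM(p,{}_3\beta(q),r)$ if there exist a constant $C$ (depending only on $a$) and a nonnegative, monotonically nondecreasing sequence $(b(n))_{n\ge1}$ of real numbers with $b(n)\to\infty$ (depending only on $a$), such that for all $n\in\mathbb{N}$ $$\left(\sum_{k=n}^{2n-1}|\Delta_r a_k|^p\right)^{1/p}\leq C\cdot {}_3\beta_n(q),\qquad {}_3\beta_n(q)=\frac1n\sup_{m\geq b(n)} m\left(\frac1m\sum_{k=m}^{2m}|a_k|^q\right)^{1/q},$$ where the supremum is over $m\in\mathbb{N}$ with $m\ge b(n)$. *)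

theory Defs
  imports "HOL-Analysis.Analysis"
begin

text \<open>
  Sequences \<open>(a\<^sub>n)\<close>, \<open>n \<ge> 1\<close>, are functions on \<^typ>\<open>nat\<close> whose value at \<open>0\<close> is never used.
\<close>

definition Delta :: "nat \<Rightarrow> (nat \<Rightarrow> complex) \<Rightarrow> nat \<Rightarrow> complex" where
  "Delta r a n = a n - a (n + r)"

text \<open>
  The supremum is taken in \<^typ>\<open>ereal\<close>, because it may be infinite for a general null sequence;
  on \<^typ>\<open>real\<close> the supremum of an unbounded set would be an unspecified number.
\<close>

definition beta3 :: "(nat \<Rightarrow> real) \<Rightarrow> real \<Rightarrow> (nat \<Rightarrow> complex) \<Rightarrow> nat \<Rightarrow> ereal" where
  "beta3 b q a n =
     ereal (1 / real n) *
     (SUP m \<in> {m::nat. 1 \<le> m \<and> b n \<le> real m}.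
        ereal (real m * (1 / real m * (\<Sum>k=m..2*m. norm (a k) powr q)) powr (1 / q)))"

definition GM_beta3 :: "real \<Rightarrow> real \<Rightarrow> nat \<Rightarrow> (nat \<Rightarrow> complex) set" where
  "GM_beta3 p q r =
     {a. a \<longlonglongrightarrow> 0 \<and>
         (\<exists>(C::real) (b :: nat \<Rightarrow> real).
            (\<forall>n\<ge>1. 0 \<le> b n) \<and> mono_on {1..} b \<and> filterlim b at_top sequentially \<and>
            (\<forall>n\<ge>1. ereal ((\<Sum>k=n..2*n-1. norm (Delta r a k) powr p) powr (1 / p))
                     \<le> ereal C * beta3 b q a n))}"

end

theory Submission
  imports Defs
begin

text \<open>
  The tails of the series are small uniformly in \<open>y = c x\<close>. Write \<open>y = \<theta> + t\<close> with \<open>\<theta>\<close> the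
  multiple of \<open>2 \<pi> / r\<close> closest to \<open>y\<close>, so that \<open>\<bar>t\<bar> \<le> \<pi> / r\<close>, and cut the range of summation
  at two places of the order of \<open>1 / \<bar>t\<bar>\<close> and \<open>(1 / \<bar>t\<bar>) powr p\<close>.

  Below \<open>1 / \<bar>t\<bar>\<close> the point \<open>y\<close> is indistinguishable from \<open>\<theta>\<close>: replacing \<open>cos (k y)\<close> by
  \<open>cos (k \<theta>)\<close> costs \<open>k \<bar>t\<bar> norm (a k)\<close> per term, in total at most \<open>n \<bar>t\<bar>\<close> times the supremum of
  \<open>k norm (a k)\<close>, and the series at \<open>\<theta>\<close> is one of the finitely many that converge by hypothesis
  (\<open>norm_cos_sum_below_inverse_distance\<close>, \<open>cos_rational_angle_reduce\<close>).

  Between the two cuts no cancellation is needed. The sum of \<open>1 / (k ln k)\<close> over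
  \<open>A < k \<le> A powr p\<close> is at most \<open>ln (p ln A) - ln (ln A) = ln p\<close> for every \<open>A \<ge> 2\<close>, and \<open>norm (a k)\<close> is
  \<open>o(1 / (k ln k))\<close> (\<open>sum_norm_power_range\<close>). This is where the logarithm in the decay
  hypothesis is spent.

  Above \<open>(1 / \<bar>t\<bar>) powr p\<close>, summation by parts with step \<open>r\<close> bounds the sum by the total variation
  of \<open>a\<close> with step \<open>r\<close>, divided by \<open>\<bar>sin (r y / 2)\<bar> = \<bar>sin (r t / 2)\<bar>\<close>, which is of the order of
  \<open>\<bar>t\<bar>\<close> (\<open>norm_cos_sum_above_power\<close>). The class condition controls the
  variation beyond \<open>m\<close> only by \<open>o(m powr (- 1 / p))\<close>, because passing from an \<open>l\<^sup>p\<close> norm to a sum over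
  a dyadic block loses a factor \<open>m powr (1 - 1 / p)\<close> (\<open>GM_beta3_sum_norm_Delta_bound\<close>). The second
  cut is placed exactly so that this is \<open>o(\<bar>t\<bar>)\<close>.
\<close>

section \<open>Elementary inequalities\<close>

lemma abs_cos_diff_le: "\<bar>cos u - cos v\<bar> \<le> \<bar>u - v\<bar>" for u v :: real
proof -
  have "\<bar>cos u - cos v\<bar> = 2 * \<bar>sin ((u + v) / 2)\<bar> * \<bar>sin ((v - u) / 2)\<bar>"
    by (simp add: cos_diff_cos abs_mult)
  also have "\<dots> \<le> 2 * 1 * \<bar>(v - u) / 2\<bar>"
    by (intro mult_mono abs_sin_x_le_abs_x) auto
  finally show ?thesis by simp
qed

text \<open>
  With \<open>w = u / 2\<close> the mean value theorem gives \<open>w cos w \<le> sin w\<close>, hence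
  \<open>sin u = 2 sin w cos w \<ge> 2 w cos\<^sup>2 w = u (1 + cos u) / 2\<close> for \<open>0 \<le> u \<le> \<pi> / 2\<close>.
\<close>
lemma abs_sin_ge_half:
  fixes u :: real
  assumes "\<bar>u\<bar> \<le> pi / 2"
  shows "\<bar>u\<bar> / 2 \<le> \<bar>sin u\<bar>"
proof -
  have pos: "v / 2 \<le> sin v" if "0 \<le> v" "v \<le> pi / 2" for v :: real
  proof (cases "v = 0")
    case False
    define w where "w = v / 2"
    have w: "0 < w" "w \<le> pi / 4" using that False by (auto simp: w_def)
    have "\<exists>z>0. z < w \<and> sin w - sin 0 = (w - 0) * cos z"
      using w by (intro MVT2) (auto intro!: derivative_eq_intros)
    then obtain z where z: "0 < z" "z < w" "sin w = w * cos z" by auto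
    have "cos w \<le> cos z" using z w pi_gt_zero by (intro cos_monotone_0_pi_le) auto
    then have sw: "w * cos w \<le> sin w" using z w by simp
    have cw: "0 \<le> cos w" using w pi_gt_zero by (intro cos_ge_zero) auto
    have "0 \<le> cos v" using that by (intro cos_ge_zero) auto
    moreover have "cos v = 2 * (cos w)\<^sup>2 - 1"
      unfolding w_def by (metis cos_double_cos field_sum_of_halves mult_2)
    ultimately have "1 \<le> 2 * (cos w * cos w)" by (simp add: power2_eq_square)
    then have "v / 2 \<le> v / 2 * (2 * (cos w * cos w))"
      using that mult_left_mono[of 1 "2 * (cos w * cos w)" "v / 2"] by simp
    also have "\<dots> = 2 * (w * cos w) * cos w" by (simp add: w_def)
    also have "\<dots> \<le> 2 * sin w * cos w" using sw cw by (intro mult_right_mono) auto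
    also have "\<dots> = sin v" using sin_double[of w] by (simp add: w_def)
    finally show ?thesis .
  qed simp
  show ?thesis
  proof (cases "0 \<le> u")
    case True
    then show ?thesis using pos[of u] assms by simp
  next
    case False
    then show ?thesis using pos[of "- u"] assms by simp
  qed
qed

text \<open>
  The sum is compared with the primitive \<open>ln (ln x)\<close> of its summand; the induction step applies
  \<open>ln u \<le> u - 1\<close> once to \<open>u = n / (n + 1)\<close> and once to the quotient of the two logarithms.
\<close>
lemma sum_inverse_mult_ln_le:
  fixes m n :: nat
  assumes "2 \<le> m" "m \<le> n"
  shows "(\<Sum>k\<in>{m<..n}. 1 / (real k * ln (real k))) \<le> ln (ln (real n)) - ln (ln (real m))"
  using assms(2)
proof (induction n rule: dec_induct)
  case (step n)
  have n: "2 \<le> n" using step assms by simp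
  define L L' where "L = ln (real n)" and "L' = ln (real (Suc n))"
  have L: "0 < L" "L < L'" using n by (auto simp: L_def L'_def)
  have "1 - real n / real (Suc n) \<le> L' - L"
    using ln_add_one_self_le_self2[of "real n / real (Suc n) - 1"] n
    by (simp add: L_def L'_def ln_div del: of_nat_Suc)
  then have "1 / real (Suc n) \<le> L' - L" by (simp add: field_simps)
  then have "1 / real (Suc n) / L' \<le> (L' - L) / L'"
    using L by (intro divide_right_mono) auto
  also have "\<dots> = 1 - L / L'" using L by (simp add: field_simps)
  also have "\<dots> \<le> - ln (L / L')" using ln_le_minus_one[of "L / L'"] L by simp
  also have "\<dots> = ln L' - ln L" using L by (simp add: ln_div)
  finally have "1 / (real (Suc n) * L') \<le> ln L' - ln L" by simp
  moreover have "{m<..Suc n} = insert (Suc n) {m<..n}" using step by auto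
  ultimately show ?case using step.IH by (simp add: L_def L'_def)
qed simp

text \<open>
  This replaces Hoelder's inequality at the cost of the factor \<open>2\<close>: after scaling, it is
  \<open>u \<le> 1 + u powr p\<close> summed over the index set.
\<close>
lemma sum_le_card_powr_times_bound:
  fixes x :: "'i \<Rightarrow> real" and p W :: real
  assumes p: "1 \<le> p" and S: "finite S" "S \<noteq> {}" and x: "\<And>i. i \<in> S \<Longrightarrow> 0 \<le> x i"
    and W: "0 < W" "(\<Sum>i\<in>S. x i powr p) powr (1 / p) \<le> W"
  shows "(\<Sum>i\<in>S. x i) \<le> 2 * real (card S) powr (1 - 1 / p) * W"
proof -
  define n where "n = real (card S)"
  have n: "0 < n" using S by (simp add: n_def card_gt_0_iff)
  \<comment> \<open>the size of the terms if the bound were attained by a constant function\<close>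
  define s where "s = W * n powr (- (1 / p))"
  have s: "0 < s" using W n by (simp add: s_def)
  have "(\<Sum>i\<in>S. x i powr p) = ((\<Sum>i\<in>S. x i powr p) powr (1 / p)) powr p"
    using p by (simp add: powr_powr sum_nonneg)
  also have "\<dots> \<le> W powr p" using W p by (intro powr_mono2) auto
  finally have Wp: "(\<Sum>i\<in>S. x i powr p) \<le> W powr p" .
  have sp: "s powr p = W powr p / n"
  proof -
    have "s powr p = W powr p * n powr (- (1 / p) * p)"
      using W n by (simp only: s_def powr_mult powr_powr)
    also have "- (1 / p) * p = - 1" using p by simp
    finally show ?thesis using n by (simp add: powr_minus_divide)
  qed
  have "x i / s \<le> 1 + (x i / s) powr p" if "i \<in> S" for i
  proof (cases "x i / s \<le> 1")
    case False
    then have "(x i / s) powr 1 \<le> (x i / s) powr p" using p by (intro powr_mono) auto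
    moreover have "(x i / s) powr 1 = x i / s" using False by (intro powr_one) linarith
    ultimately show ?thesis by linarith
  qed (simp add: add_increasing2)
  then have "(\<Sum>i\<in>S. x i / s) \<le> (\<Sum>i\<in>S. 1 + (x i / s) powr p)" by (intro sum_mono)
  also have "\<dots> = n + (\<Sum>i\<in>S. x i powr p) / s powr p"
    using x s by (simp add: sum.distrib n_def powr_divide sum_divide_distrib)
  also have "\<dots> \<le> n + W powr p / s powr p"
    using Wp by (intro add_left_mono divide_right_mono) auto
  also have "\<dots> = 2 * n" using W n by (simp add: sp)
  finally have "(\<Sum>i\<in>S. x i) \<le> 2 * n * s"
    using s by (simp add: field_simps flip: sum_divide_distrib)
  also have "\<dots> = 2 * n powr (1 - 1 / p) * W"
    using n by (simp add: s_def powr_diff powr_minus_divide)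
  finally show ?thesis by (simp add: n_def)
qed

text \<open>
  The blocks \<open>[m, 2 m)\<close>, \<open>[2 m, 4 m)\<close>, \<dots> contribute a geometric series with ratio
  \<open>2 powr (- s)\<close>. The induction is on the length of the range and splits off the first block.
\<close>
lemma sum_tail_le_of_dyadic_blocks:
  fixes d :: "nat \<Rightarrow> real" and s D :: real
  assumes s: "0 < s" and D: "0 \<le> D" and d: "\<And>k. 0 \<le> d k" and N: "1 \<le> N" "N \<le> m"
    and block: "\<And>k. N \<le> k \<Longrightarrow> (\<Sum>j=k..2*k-1. d j) \<le> D * real k powr (- s)"
  shows "(\<Sum>j=m..n. d j) \<le> D / (1 - 2 powr (- s)) * real m powr (- s)"
  using N(2)
proof (induction "n - m" arbitrary: m rule: less_induct)
  case less
  define K where "K = D / (1 - 2 powr (- s))"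
  have "2 powr (- s) < 2 powr (0::real)" using s by (intro powr_less_mono) auto
  then have q: "2 powr (- s) < 1" by simp
  have K: "0 \<le> K" using q D by (simp add: K_def)
  \<comment> \<open>the geometric series in its self-similar form\<close>
  have KD: "D + K * 2 powr (- s) = K"
  proof -
    have "1 - 2 powr (- s) \<noteq> 0" using q by linarith
    then have "K * (1 - 2 powr (- s)) = D"
      using nonzero_eq_divide_eq K_def by blast
    then show ?thesis by (simp add: right_diff_distrib)
  qed
  have m: "1 \<le> m" using less.prems N by simp
  have "(\<Sum>j=m..n. d j) \<le> (\<Sum>j\<in>{m..2*m-1} \<union> {2*m..n}. d j)"
    using m d by (intro sum_mono2) auto
  also have "\<dots> = (\<Sum>j=m..2*m-1. d j) + (\<Sum>j=2*m..n. d j)"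
    using m by (intro sum.union_disjoint) auto
  also have "(\<Sum>j=2*m..n. d j) \<le> K * real (2 * m) powr (- s)"
  proof (cases "n < 2 * m")
    case False
    then show ?thesis unfolding K_def using m less.prems by (intro less.hyps) auto
  qed (use K in simp)
  also have "(\<Sum>j=m..2*m-1. d j) \<le> D * real m powr (- s)" using block less.prems by simp
  also have "D * real m powr (- s) + K * real (2 * m) powr (- s)
      = (D + K * 2 powr (- s)) * real m powr (- s)"
    using m by (simp add: powr_mult algebra_simps)
  finally show ?case unfolding KD by (simp add: K_def)
qed

section \<open>Consequences of the class condition\<close>

text \<open>
  If \<open>k norm (a k) \<le> e'\<close> for \<open>k \<ge> m\<close>, the \<open>q\<close>-mean of \<open>norm (a k)\<close> over \<open>[m, 2 m]\<close> is at most
  \<open>2 e' / m\<close>. Since \<open>b n\<close> tends to infinity, this covers every \<open>m\<close> in the supremum once \<open>n\<close> is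
  large. The constant \<open>C\<close> of the class may be negative, so the bound is made in terms of \<open>\<bar>C\<bar>\<close>; that
  requires the supremum to be nonnegative, hence taken over a nonempty set.
\<close>
lemma GM_beta3_block_norm_bound:
  fixes a :: "nat \<Rightarrow> complex"
  assumes q: "1 \<le> q" and a: "a \<in> GM_beta3 p q r"
    and lim: "(\<lambda>n. real n * norm (a n)) \<longlonglongrightarrow> 0" and e: "0 < e"
  shows "\<forall>\<^sub>F n in sequentially.
           (\<Sum>k=n..2*n-1. norm (Delta r a k) powr p) powr (1 / p) \<le> e / real n"
proof -
  from a obtain C and b :: "nat \<Rightarrow> real" where b: "filterlim b at_top sequentially"
    and Cb: "\<And>n. 1 \<le> n \<Longrightarrow> ereal ((\<Sum>k=n..2*n-1. norm (Delta r a k) powr p) powr (1 / p))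
                     \<le> ereal C * beta3 b q a n"
    unfolding GM_beta3_def by blast
  define e' where "e' = e / (2 * (\<bar>C\<bar> + 1))"
  have e': "0 < e'" using e by (simp add: e'_def add_nonneg_pos)
  have "\<forall>\<^sub>F n in sequentially. real n * norm (a n) < e'"
    using order_tendstoD(2)[OF lim e'] .
  then obtain M where M: "\<And>k. M \<le> k \<Longrightarrow> real k * norm (a k) \<le> e'"
    unfolding eventually_sequentially by (meson less_imp_le)
  have "\<forall>\<^sub>F n in sequentially. real M \<le> b n" using b by (simp add: filterlim_at_top)
  then show ?thesis using eventually_ge_at_top[of 1]
  proof eventually_elim
    case (elim n)
    define F where "F m = real m * (1 / real m * (\<Sum>k=m..2*m. norm (a k) powr q)) powr (1 / q)"
      for m
    define I where "I = {m::nat. 1 \<le> m \<and> b n \<le> real m}"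
    have F: "F m \<le> 2 * e'" if "m \<in> I" for m
    proof -
      have m: "1 \<le> m" "M \<le> m" using that elim by (auto simp: I_def)
      have "norm (a k) powr q \<le> (e' / real m) powr q" if "k \<in> {m..2*m}" for k
      proof (rule powr_mono2)
        have "real m * norm (a k) \<le> real k * norm (a k)"
          using that by (intro mult_right_mono) auto
        also have "\<dots> \<le> e'" using M that m by simp
        finally show "norm (a k) \<le> e' / real m" using m by (simp add: field_simps)
      qed (use q in auto)
      then have "(\<Sum>k=m..2*m. norm (a k) powr q) \<le> (\<Sum>k=m..2*m. (e' / real m) powr q)"
        by (intro sum_mono)
      also have "\<dots> = real (m + 1) * (e' / real m) powr q" by simp
      finally have "1 / real m * (\<Sum>k=m..2*m. norm (a k) powr q)
          \<le> 1 / real m * (real (m + 1) * (e' / real m) powr q)"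
        by (intro mult_left_mono) auto
      also have "\<dots> = real (m + 1) / real m * (e' / real m) powr q" by simp
      also have "\<dots> \<le> 2 * (e' / real m) powr q"
        using m by (intro mult_right_mono) (auto simp: field_simps)
      finally have "(1 / real m * (\<Sum>k=m..2*m. norm (a k) powr q)) powr (1 / q)
          \<le> (2 * (e' / real m) powr q) powr (1 / q)"
        using q by (intro powr_mono2) (auto intro!: divide_nonneg_nonneg sum_nonneg)
      also have "\<dots> = 2 powr (1 / q) * (e' / real m)"
        using q e' m by (simp add: powr_mult powr_powr)
      also have "\<dots> \<le> 2 powr 1 * (e' / real m)"
        using q e' by (intro mult_right_mono powr_mono) auto
      finally have "F m \<le> real m * (2 * (e' / real m))"
        unfolding F_def by (intro mult_left_mono) auto
      then show ?thesis using m by simp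
    qed
    have Sup: "(SUP m\<in>I. ereal (F m)) \<le> ereal (2 * e')" using F by (intro SUP_least) auto
    obtain m0 :: nat where "max 1 (b n) \<le> real m0" using real_arch_simple by blast
    then have m0: "m0 \<in> I" by (auto simp: I_def)
    have "0 \<le> ereal (F m0)" by (simp add: F_def)
    also have "\<dots> \<le> (SUP m\<in>I. ereal (F m))" using m0 by (rule SUP_upper)
    finally have Sup0: "0 \<le> (SUP m\<in>I. ereal (F m))" .
    have beta: "beta3 b q a n = ereal (1 / real n) * (SUP m\<in>I. ereal (F m))"
      by (simp add: beta3_def F_def I_def)
    have beta0: "0 \<le> beta3 b q a n" unfolding beta using Sup0 by simp
    have "ereal ((\<Sum>k=n..2*n-1. norm (Delta r a k) powr p) powr (1 / p)) \<le> ereal C * beta3 b q a n"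
      using Cb elim by simp
    also have "\<dots> \<le> ereal \<bar>C\<bar> * beta3 b q a n"
      using beta0 by (intro ereal_mult_right_mono) auto
    also have "\<dots> \<le> ereal \<bar>C\<bar> * (ereal (1 / real n) * ereal (2 * e'))"
      unfolding beta using Sup by (intro ereal_mult_left_mono) auto
    also have "\<dots> = ereal (\<bar>C\<bar> * (1 / real n * (2 * e')))" by simp
    finally have "(\<Sum>k=n..2*n-1. norm (Delta r a k) powr p) powr (1 / p)
        \<le> \<bar>C\<bar> * (1 / real n * (2 * e'))" by simp
    also have "\<dots> = \<bar>C\<bar> / (\<bar>C\<bar> + 1) * (e / real n)"
  proof -
    have "2 * e' = e / (\<bar>C\<bar> + 1)"
      by (simp only: e'_def times_divide_eq_right mult_divide_mult_cancel_left_if) simp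
    then show ?thesis by simp
  qed
    also have "\<dots> \<le> 1 * (e / real n)" using e by (intro mult_right_mono) auto
    finally show ?case by simp
  qed
qed

lemma GM_beta3_sum_norm_Delta_bound:
  fixes a :: "nat \<Rightarrow> complex"
  assumes p: "1 < p" and q: "1 \<le> q" and a: "a \<in> GM_beta3 p q r"
    and lim: "(\<lambda>n. real n * norm (a n)) \<longlonglongrightarrow> 0" and e: "0 < e"
  shows "\<forall>\<^sub>F m in sequentially. \<forall>n. (\<Sum>k=m..n. norm (Delta r a k))
           \<le> 2 / (1 - 2 powr (- (1 / p))) * e * real m powr (- (1 / p))"
proof -
  obtain N where N: "\<And>n. N \<le> n \<Longrightarrow>
      (\<Sum>k=n..2*n-1. norm (Delta r a k) powr p) powr (1 / p) \<le> e / real n"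
    using GM_beta3_block_norm_bound[OF q a lim e] unfolding eventually_sequentially by blast
  have block: "(\<Sum>k=n..2*n-1. norm (Delta r a k)) \<le> (2 * e) * real n powr (- (1 / p))"
    if "max 1 N \<le> n" for n
  proof -
    have "(\<Sum>k=n..2*n-1. norm (Delta r a k))
        \<le> 2 * real (card {n..2*n-1}) powr (1 - 1 / p) * (e / real n)"
      using that p e N by (intro sum_le_card_powr_times_bound) auto
    also have "card {n..2*n-1} = n" using that by simp
    also have "2 * real n powr (1 - 1 / p) * (e / real n) = (2 * e) * real n powr (- (1 / p))"
      using that by (simp add: powr_diff powr_minus_divide)
    finally show ?thesis .
  qed
  have "(\<Sum>k=m..n. norm (Delta r a k))
      \<le> (2 * e) / (1 - 2 powr (- (1 / p))) * real m powr (- (1 / p))" if "max 1 N \<le> m" for m n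
    using p e that block by (intro sum_tail_le_of_dyadic_blocks[where N = "max 1 N"]) auto
  then show ?thesis unfolding eventually_sequentially by (intro exI[of _ "max 1 N"]) auto
qed

section \<open>Summation by parts with step \<open>r\<close>\<close>

lemma sum_shift_diff:
  fixes f :: "nat \<Rightarrow> 'a::ab_group_add"
  assumes "m \<le> n"
  shows "(\<Sum>k\<in>{m<..n}. f (k + r) - f k) = (\<Sum>k\<in>{n<..n+r}. f k) - (\<Sum>k\<in>{m<..m+r}. f k)"
proof -
  have "(\<Sum>k\<in>{m<..n}. f (k + r)) = (\<Sum>k\<in>{m+r<..n+r}. f k)"
    by (rule sum.reindex_bij_witness[of _ "\<lambda>k. k - r" "\<lambda>k. k + r"]) auto
  moreover have "(\<Sum>k\<in>{m<..n+r}. f k) = (\<Sum>k\<in>{m<..m+r}. f k) + (\<Sum>k\<in>{m+r<..n+r}. f k)"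
    using assms by (subst sum.union_disjoint[symmetric]) (auto intro!: sum.cong)
  moreover have "(\<Sum>k\<in>{m<..n+r}. f k) = (\<Sum>k\<in>{m<..n}. f k) + (\<Sum>k\<in>{n<..n+r}. f k)"
    using assms by (subst sum.union_disjoint[symmetric]) (auto intro!: sum.cong)
  ultimately show ?thesis by (simp add: sum_subtractf algebra_simps)
qed

text \<open>
  From \<open>2 sin (r y / 2) cos (k y) = sin ((k + r / 2) y) - sin ((k - r / 2) y)\<close>: the two sines are
  the same function at indices \<open>r\<close> apart, so the differences move onto \<open>a\<close>, up to \<open>r\<close> boundary terms at
  each end.
\<close>
lemma norm_sum_cos_by_parts:
  fixes a :: "nat \<Rightarrow> complex" and y :: real
  assumes "m \<le> n"
  shows "2 * \<bar>sin (real r * y / 2)\<bar> * norm (\<Sum>k\<in>{m<..n}. a k * of_real (cos (real k * y)))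
    \<le> (\<Sum>k\<in>{m<..n}. norm (Delta r a k)) + (\<Sum>k\<in>{n<..n+r}. norm (a k)) + (\<Sum>k\<in>{m<..m+r}. norm (a k))"
proof -
  define S where "S k = (of_real (sin (real k * y + real r * y / 2)) :: complex)" for k
  define f where "f k = a k * of_real (sin (real k * y - real r * y / 2))" for k
  have S: "norm (S k) \<le> 1" for k unfolding S_def by simp
  have f: "norm (f k) \<le> norm (a k)" for k
    unfolding f_def by (simp add: norm_mult mult_left_le)
  have fr: "f (k + r) = a (k + r) * S k" for k
  proof -
    have "real (k + r) * y - real r * y / 2 = real k * y + real r * y / 2"
      by (simp add: algebra_simps)
    then show ?thesis by (simp only: f_def S_def)
  qed
  have "of_real (2 * sin (real r * y / 2)) * (a k * of_real (cos (real k * y)))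
      = Delta r a k * S k + (f (k + r) - f k)" for k
  proof -
    have "2 * sin (real r * y / 2) * cos (real k * y)
        = sin (real k * y + real r * y / 2) - sin (real k * y - real r * y / 2)"
      by (simp add: sin_add sin_diff)
    then have "of_real (2 * sin (real r * y / 2) * cos (real k * y))
        = S k - of_real (sin (real k * y - real r * y / 2))"
      by (metis S_def of_real_diff)
    then have "of_real (2 * sin (real r * y / 2)) * (a k * of_real (cos (real k * y)))
        = a k * (S k - of_real (sin (real k * y - real r * y / 2)))"
      by (simp add: mult_ac)
    then show ?thesis unfolding fr by (simp add: Delta_def f_def algebra_simps)
  qed
  then have "of_real (2 * sin (real r * y / 2)) * (\<Sum>k\<in>{m<..n}. a k * of_real (cos (real k * y)))
      = (\<Sum>k\<in>{m<..n}. Delta r a k * S k) + (\<Sum>k\<in>{m<..n}. f (k + r) - f k)"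
    by (simp add: sum_distrib_left sum.distrib)
  also have "(\<Sum>k\<in>{m<..n}. f (k + r) - f k) = (\<Sum>k\<in>{n<..n+r}. f k) - (\<Sum>k\<in>{m<..m+r}. f k)"
    using assms by (rule sum_shift_diff)
  finally have "norm (of_real (2 * sin (real r * y / 2)) * (\<Sum>k\<in>{m<..n}. a k * of_real (cos (real k * y))))
      \<le> norm (\<Sum>k\<in>{m<..n}. Delta r a k * S k) + (norm (\<Sum>k\<in>{n<..n+r}. f k) + norm (\<Sum>k\<in>{m<..m+r}. f k))"
    by (simp only:) (intro order_trans[OF norm_triangle_ineq] add_left_mono norm_triangle_ineq4)
  also have "norm (\<Sum>k\<in>{m<..n}. Delta r a k * S k) \<le> (\<Sum>k\<in>{m<..n}. norm (Delta r a k))"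
    using S by (intro sum_norm_le) (simp add: norm_mult mult_left_le)
  also have "norm (\<Sum>k\<in>{n<..n+r}. f k) \<le> (\<Sum>k\<in>{n<..n+r}. norm (a k))"
    using f by (intro sum_norm_le) auto
  also have "norm (\<Sum>k\<in>{m<..m+r}. f k) \<le> (\<Sum>k\<in>{m<..m+r}. norm (a k))"
    using f by (intro sum_norm_le) auto
  also have "norm (of_real (2 * sin (real r * y / 2)) * (\<Sum>k\<in>{m<..n}. a k * of_real (cos (real k * y))))
      = 2 * \<bar>sin (real r * y / 2)\<bar> * norm (\<Sum>k\<in>{m<..n}. a k * of_real (cos (real k * y)))"
    by (simp add: norm_mult abs_mult)
  finally show ?thesis by simp
qed

section \<open>The three ranges of summation\<close>

lemma norm_cos_sum_below_inverse_distance: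
  fixes a :: "nat \<Rightarrow> complex" and t \<theta> e R :: real
  assumes small: "\<And>k. m < k \<Longrightarrow> real k * norm (a k) \<le> e"
    and tail: "norm (\<Sum>k\<in>{m<..n}. a k * of_real (cos (real k * \<theta>))) \<le> e"
    and R: "real n * \<bar>t\<bar> \<le> R" and e: "0 \<le> e"
  shows "norm (\<Sum>k\<in>{m<..n}. a k * of_real (cos (real k * (\<theta> + t)))) \<le> (1 + R) * e"
proof -
  let ?d = "\<lambda>k. a k * of_real (cos (real k * (\<theta> + t)) - cos (real k * \<theta>))"
  have d: "norm (?d k) \<le> e * \<bar>t\<bar>" if "k \<in> {m<..n}" for k
  proof -
    have "norm (?d k) = norm (a k) * \<bar>cos (real k * (\<theta> + t)) - cos (real k * \<theta>)\<bar>"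
      by (simp only: norm_mult norm_of_real)
    also have "\<dots> \<le> norm (a k) * \<bar>real k * (\<theta> + t) - real k * \<theta>\<bar>"
      by (intro mult_left_mono abs_cos_diff_le) auto
    also have "\<dots> = (real k * norm (a k)) * \<bar>t\<bar>" by (simp add: algebra_simps abs_mult)
    also have "\<dots> \<le> e * \<bar>t\<bar>" using small that by (intro mult_right_mono) auto
    finally show ?thesis .
  qed
  have "norm (\<Sum>k\<in>{m<..n}. ?d k) \<le> (\<Sum>k\<in>{m<..n}. e * \<bar>t\<bar>)"
    using d by (intro sum_norm_le) auto
  also have "\<dots> = real (n - m) * (e * \<bar>t\<bar>)" by simp
  also have "\<dots> \<le> real n * (e * \<bar>t\<bar>)" using e by (intro mult_right_mono) auto
  also have "\<dots> \<le> R * e" using mult_right_mono[OF R e] by (simp add: mult_ac)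
  finally have "norm (\<Sum>k\<in>{m<..n}. ?d k) \<le> R * e" .
  moreover have "(\<Sum>k\<in>{m<..n}. a k * of_real (cos (real k * (\<theta> + t))))
      = (\<Sum>k\<in>{m<..n}. a k * of_real (cos (real k * \<theta>))) + (\<Sum>k\<in>{m<..n}. ?d k)"
    by (simp add: sum.distrib[symmetric] algebra_simps)
  ultimately show ?thesis
    using tail norm_triangle_ineq[of "\<Sum>k\<in>{m<..n}. a k * of_real (cos (real k * \<theta>))" "\<Sum>k\<in>{m<..n}. ?d k"]
    by (simp add: algebra_simps)
qed

text \<open>
  The interval \<open>(m, m powr p]\<close> has length \<open>ln p\<close>, independent of \<open>m\<close>, on the scale \<open>ln (ln x)\<close>.
\<close>
lemma sum_norm_power_range:
  fixes a :: "nat \<Rightarrow> complex" and p e :: real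
  assumes m: "2 \<le> m" "m \<le> n" and n: "real n \<le> real m powr p" and e: "0 \<le> e"
    and small: "\<And>k. m < k \<Longrightarrow> real k * ln (real k) * norm (a k) \<le> e"
  shows "(\<Sum>k\<in>{m<..n}. norm (a k)) \<le> ln p * e"
proof -
  have "(\<Sum>k\<in>{m<..n}. norm (a k)) \<le> (\<Sum>k\<in>{m<..n}. e * (1 / (real k * ln (real k))))"
  proof (intro sum_mono)
    fix k assume "k \<in> {m<..n}"
    then have "0 < real k * ln (real k)" "real k * ln (real k) * norm (a k) \<le> e"
      using m small by auto
    then show "norm (a k) \<le> e * (1 / (real k * ln (real k)))" by (simp add: pos_le_divide_eq mult.commute)
  qed
  also have "\<dots> = e * (\<Sum>k\<in>{m<..n}. 1 / (real k * ln (real k)))" by (simp only: sum_distrib_left)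
  also have "\<dots> \<le> e * (ln (ln (real n)) - ln (ln (real m)))"
    using m e by (intro mult_left_mono sum_inverse_mult_ln_le) auto
  also have "\<dots> \<le> e * ln p"
  proof (intro mult_left_mono e)
    have lm: "0 < ln (real m)" and ln: "0 < ln (real n)" using m by auto
    have "ln (real n) \<le> ln (real m powr p)" using n m by (subst ln_le_cancel_iff) auto
    then have le: "ln (real n) \<le> p * ln (real m)" using m by (simp add: ln_powr)
    then have p: "0 < p" using lm ln by (metis less_le_trans zero_less_mult_pos2)
    have "ln (ln (real n)) \<le> ln (p * ln (real m))" using le ln by (subst ln_le_cancel_iff) auto
    then show "ln (ln (real n)) - ln (ln (real m)) \<le> ln p" using p lm by (simp add: ln_mult)
  qed
  finally show ?thesis by (simp add: mult.commute)
qed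

text \<open>
  Here \<open>y\<close> and \<open>t\<close> differ by a multiple of \<open>2 \<pi> / r\<close>, of which only the equality of
  \<open>\<bar>sin (r y / 2)\<bar>\<close> and \<open>\<bar>sin (r t / 2)\<bar>\<close> matters. This number is at least \<open>r \<bar>t\<bar> / 4\<close>, while the
  variation and, as \<open>1 / (m + 1) \<le> (m + 1) powr (- 1 / p)\<close>, also the boundary terms are \<open>O(e \<bar>t\<bar>)\<close>.
\<close>
lemma norm_cos_sum_above_power:
  fixes a :: "nat \<Rightarrow> complex" and y t p e K :: real
  assumes p: "1 \<le> p" and r: "1 \<le> r" and e: "0 \<le> e" and K: "0 \<le> K" and mn: "m \<le> n"
    and t: "0 < \<bar>t\<bar>" "\<bar>t\<bar> \<le> pi / real r"
    and y: "\<bar>sin (real r * y / 2)\<bar> = \<bar>sin (real r * t / 2)\<bar>"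
    and m: "real (Suc m) powr (- (1 / p)) \<le> \<bar>t\<bar>"
    and small: "\<And>k. m < k \<Longrightarrow> real k * norm (a k) \<le> e"
    and D: "(\<Sum>k=Suc m..n. norm (Delta r a k)) \<le> K * e * real (Suc m) powr (- (1 / p))"
  shows "norm (\<Sum>k\<in>{m<..n}. a k * of_real (cos (real k * y))) \<le> (2 * K + 4) * e"
proof -
  let ?T = "norm (\<Sum>k\<in>{m<..n}. a k * of_real (cos (real k * y)))"
  have "real (Suc m) powr (- 1) \<le> real (Suc m) powr (- (1 / p))"
    using p by (intro powr_mono) auto
  then have m': "1 / real (Suc m) \<le> \<bar>t\<bar>" using m by (simp add: powr_minus_divide)
  have edge: "(\<Sum>k\<in>{l<..l+r}. norm (a k)) \<le> real r * (e * \<bar>t\<bar>)" if "m \<le> l" for l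
  proof -
    have "norm (a k) \<le> e * \<bar>t\<bar>" if k: "k \<in> {l<..l+r}" for k
    proof -
      have "norm (a k) \<le> e * (1 / real k)"
        using small[of k] k \<open>m \<le> l\<close> by (simp add: field_simps)
      also have "\<dots> \<le> e * (1 / real (Suc m))"
        using k \<open>m \<le> l\<close> e by (intro mult_left_mono divide_left_mono) auto
      also have "\<dots> \<le> e * \<bar>t\<bar>" using m' e by (intro mult_left_mono)
      finally show ?thesis .
    qed
    then have "(\<Sum>k\<in>{l<..l+r}. norm (a k)) \<le> (\<Sum>k\<in>{l<..l+r}. e * \<bar>t\<bar>)" by (intro sum_mono)
    then show ?thesis by simp
  qed
  have "\<bar>real r * t / 2\<bar> = real r * \<bar>t\<bar> / 2" by (simp add: abs_mult)
  moreover have "real r * \<bar>t\<bar> \<le> pi" using t r by (simp add: field_simps)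
  ultimately have "real r * \<bar>t\<bar> / 2 / 2 \<le> \<bar>sin (real r * t / 2)\<bar>"
    using abs_sin_ge_half[of "real r * t / 2"] by simp
  then have "real r * \<bar>t\<bar> / 2 * ?T \<le> 2 * \<bar>sin (real r * y / 2)\<bar> * ?T"
    unfolding y by (intro mult_right_mono) auto
  also have "\<dots> \<le> (\<Sum>k\<in>{m<..n}. norm (Delta r a k)) + (\<Sum>k\<in>{n<..n+r}. norm (a k)) + (\<Sum>k\<in>{m<..m+r}. norm (a k))"
    using mn by (rule norm_sum_cos_by_parts)
  also have "\<dots> \<le> K * e * \<bar>t\<bar> + real r * (e * \<bar>t\<bar>) + real r * (e * \<bar>t\<bar>)"
  proof (intro add_mono edge)
    have "{m<..n} = {Suc m..n}" by auto
    then show "(\<Sum>k\<in>{m<..n}. norm (Delta r a k)) \<le> K * e * \<bar>t\<bar>"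
      using D mult_left_mono[OF m, of "K * e"] K e by simp
  qed (use mn in auto)
  also have "\<dots> = \<bar>t\<bar> * ((K + 2 * real r) * e)" by (simp add: algebra_simps)
  also have "\<dots> \<le> \<bar>t\<bar> * (real r * ((K + 2) * e))"
  proof (intro mult_left_mono)
    have "K \<le> real r * K" using r K mult_right_mono[of 1 "real r" K] by simp
    then have "(K + 2 * real r) * e \<le> (real r * (K + 2)) * e"
      using e by (intro mult_right_mono) (auto simp: algebra_simps)
    then show "(K + 2 * real r) * e \<le> real r * ((K + 2) * e)" by (simp only: mult.assoc)
  qed simp
  finally have "(real r * \<bar>t\<bar>) * (?T / 2) \<le> (real r * \<bar>t\<bar>) * ((K + 2) * e)" by (simp add: mult_ac)
  then have "?T / 2 \<le> (K + 2) * e" using t r by (subst (asm) mult_le_cancel_left_pos) auto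
  then show ?thesis by (simp add: algebra_simps)
qed

section \<open>Uniform smallness of the tails\<close>

lemma sum_greaterThanAtMost_split:
  fixes f :: "nat \<Rightarrow> 'a::comm_monoid_add"
  assumes "l \<le> m" "m \<le> n"
  shows "(\<Sum>k\<in>{l<..n}. f k) = (\<Sum>k\<in>{l<..m}. f k) + (\<Sum>k\<in>{m<..n}. f k)"
  using assms by (subst sum.union_disjoint[symmetric]) (auto intro!: sum.cong)

text \<open>
  The three ranges put together. The constant does not depend on \<open>y\<close>; its three summands belong to
  the ranges in order.
\<close>
lemma norm_cos_sum_tail_le:
  fixes a :: "nat \<Rightarrow> complex" and p e K :: real
  assumes p: "1 < p" and r: "1 \<le> r" and e: "0 \<le> e" and K: "0 \<le> K" and N: "2 \<le> N" "N \<le> m" "m \<le> n"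
    and small: "\<And>k. N \<le> k \<Longrightarrow> real k * norm (a k) \<le> e"
    and small_ln: "\<And>k. N \<le> k \<Longrightarrow> real k * ln (real k) * norm (a k) \<le> e"
    and D: "\<And>k l. N \<le> k \<Longrightarrow> (\<Sum>j=k..l. norm (Delta r a j)) \<le> K * e * real k powr (- (1 / p))"
    and tails: "\<And>j::int. \<And>k l. N \<le> k \<Longrightarrow> norm (\<Sum>i\<in>{k<..l}. a i * of_real (cos (real i * (2 * pi * of_int j / real r)))) \<le> e"
  shows "norm (\<Sum>k\<in>{m<..n}. a k * of_real (cos (real k * y))) \<le> (6 + ln p + (2 * K + 4)) * e"
proof -
  define j where "j = round (real r * y / (2 * pi))"
  define \<theta> where "\<theta> = 2 * pi * of_int j / real r"
  define t where "t = y - \<theta>"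
  let ?f = "\<lambda>k. a k * of_real (cos (real k * y)) :: complex"
  have y: "y = \<theta> + t" by (simp add: t_def)
  have "t = - (of_int j - real r * y / (2 * pi)) * (2 * pi / real r)"
    using r by (simp add: t_def \<theta>_def field_simps)
  then have "\<bar>t\<bar> = \<bar>of_int j - real r * y / (2 * pi)\<bar> * (2 * pi / real r)"
    by (simp only: abs_mult abs_minus_cancel) simp
  also have "\<dots> \<le> 1 / 2 * (2 * pi / real r)"
    unfolding j_def by (intro mult_right_mono of_int_round_abs_le) auto
  finally have t: "\<bar>t\<bar> \<le> pi / real r" by simp
  have "pi / real r \<le> pi / 1" using r by (intro divide_left_mono) auto
  then have t4: "\<bar>t\<bar> \<le> 4" using t pi_less_4 by linarith
  have lnp: "0 \<le> ln p" using p by simp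
  have head: "norm (\<Sum>k\<in>{m<..n'}. ?f k) \<le> 6 * e" if "real n' * \<bar>t\<bar> \<le> 5" for n'
  proof -
    have "norm (\<Sum>k\<in>{m<..n'}. a k * of_real (cos (real k * (\<theta> + t)))) \<le> (1 + 5) * e"
      using N e small that tails[where k = m and l = n' and j = j]
      by (intro norm_cos_sum_below_inverse_distance) (auto simp: \<theta>_def)
    then show ?thesis by (simp add: y)
  qed
  show ?thesis
  proof (cases "t = 0")
    case True
    then have "norm (\<Sum>k\<in>{m<..n}. ?f k) \<le> 6 * e" using head[of n] by simp
    moreover have "6 * e \<le> (6 + ln p + (2 * K + 4)) * e"
      using e K lnp by (intro mult_right_mono) auto
    ultimately show ?thesis by linarith
  next
    case False
    then have t0: "0 < \<bar>t\<bar>" by simp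
    define A where "A = nat \<lceil>1 / \<bar>t\<bar>\<rceil>"
    define B where "B = nat \<lfloor>real A powr p\<rfloor>"
    have c0: "0 < 1 / \<bar>t\<bar>" using t0 by simp
    have A: "1 / \<bar>t\<bar> \<le> real A" "real A \<le> 1 / \<bar>t\<bar> + 1"
      unfolding A_def using c0 by linarith+
    have "real A * \<bar>t\<bar> \<le> (1 / \<bar>t\<bar> + 1) * \<bar>t\<bar>" using A by (intro mult_right_mono) auto
    also have "\<dots> = 1 + \<bar>t\<bar>" using t0 by (simp add: field_simps)
    finally have At: "real A * \<bar>t\<bar> \<le> 5" using t4 by simp
    have B: "real B \<le> real A powr p" "real A powr p \<le> real (Suc B)"
      unfolding B_def using powr_ge_zero[of "real A" p] by linarith+
    have A1: "1 \<le> real A" using A c0 by (cases A) auto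
    \<comment> \<open>the cuts \<open>A\<close> and \<open>B\<close> clipped to \<open>[m, n]\<close>; any of the three ranges may become empty\<close>
    define m1 where "m1 = max m (min n A)"
    define m2 where "m2 = max m1 (min n B)"
    have ord: "m \<le> m1" "m1 \<le> m2" "m2 \<le> n" using N by (auto simp: m1_def m2_def)
    have s1: "norm (\<Sum>k\<in>{m<..m1}. ?f k) \<le> 6 * e"
    proof (cases "m1 = m")
      case False
      then have "m1 \<le> A" by (auto simp: m1_def)
      then have "real m1 * \<bar>t\<bar> \<le> real A * \<bar>t\<bar>" by (intro mult_right_mono) auto
      then show ?thesis using At by (intro head) simp
    qed (use e in simp)
    have s2: "norm (\<Sum>k\<in>{m1<..m2}. ?f k) \<le> ln p * e"
    proof (cases "m2 = m1")
      case False
      then have m2: "m2 \<le> B" "A \<le> m1" using ord by (auto simp: m1_def m2_def)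
      have "norm (\<Sum>k\<in>{m1<..m2}. ?f k) \<le> (\<Sum>k\<in>{m1<..m2}. norm (a k))"
        by (intro sum_norm_le) (simp add: norm_mult mult_left_le)
      also have "\<dots> \<le> ln p * e"
      proof (intro sum_norm_power_range)
        have "real m2 \<le> real A powr p" using m2 B by linarith
        also have "\<dots> \<le> real m1 powr p" using m2 p by (intro powr_mono2) auto
        finally show "real m2 \<le> real m1 powr p" .
      qed (use N ord e small_ln in auto)
      finally show ?thesis .
    qed (use e lnp in simp)
    have s3: "norm (\<Sum>k\<in>{m2<..n}. ?f k) \<le> (2 * K + 4) * e"
    proof (cases "m2 = n")
      case False
      then have m2: "B \<le> m2" using ord by (auto simp: m2_def)
      show ?thesis
      proof (rule norm_cos_sum_above_power[where p = p and r = r and t = t])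
        have "real (Suc m2) powr (- (1 / p)) \<le> (real A powr p) powr (- (1 / p))"
          using B(2) m2 A1 p by (intro powr_mono2') auto
        also have "\<dots> = 1 / real A" using p A1 by (simp add: powr_powr powr_minus_divide)
        also have "\<dots> \<le> \<bar>t\<bar>" using A(1) A1 t0 by (simp add: field_simps)
        finally show "real (Suc m2) powr (- (1 / p)) \<le> \<bar>t\<bar>" .
        have "real r * y / 2 = real r * t / 2 + pi * of_int j"
          using r by (simp add: y \<theta>_def field_simps)
        then have "sin (real r * y / 2) = sin (real r * t / 2) * cos (pi * of_int j)"
          by (simp only: sin_add sin_npi_int)
        moreover have "\<bar>cos (pi * real_of_int j)\<bar> = 1" by simp
        ultimately show "\<bar>sin (real r * y / 2)\<bar> = \<bar>sin (real r * t / 2)\<bar>"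
          by (simp add: abs_mult)
      qed (use p r e K ord t t0 N small D in \<open>auto simp del: of_nat_Suc\<close>)
    qed (use e K in simp)
    have "(\<Sum>k\<in>{m<..n}. ?f k) = (\<Sum>k\<in>{m<..m1}. ?f k) + (\<Sum>k\<in>{m1<..m2}. ?f k) + (\<Sum>k\<in>{m2<..n}. ?f k)"
      using ord sum_greaterThanAtMost_split[of m m1 n ?f] sum_greaterThanAtMost_split[of m1 m2 n ?f]
      by (simp add: add.assoc)
    also have "norm \<dots> \<le> 6 * e + ln p * e + (2 * K + 4) * e"
      using s1 s2 s3 by (intro order_trans[OF norm_triangle_ineq] add_mono) auto
    finally show ?thesis by (simp add: algebra_simps)
  qed
qed

section \<open>The exceptional points\<close>

text \<open>
  Evenness and periodicity of the cosine reduce all multiples of \<open>2 \<pi> / r\<close> to the finitely many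
  with \<open>0 \<le> l \<le> r / 2\<close>, which makes the bounds at these points uniform.
\<close>
lemma cos_rational_angle_reduce:
  fixes j :: int and r :: nat
  assumes r: "1 \<le> r"
  obtains l :: nat where "l \<le> r div 2"
    "\<And>k::nat. cos (real k * (2 * pi * of_int j / real r)) = cos (2 * real l * pi / real r * real k)"
proof -
  define i where "i = j div int r"
  define s where "s = nat (j mod int r)"
  have s: "int s = j mod int r" using r by (simp add: s_def)
  have slt: "s < r" using r by (simp add: s_def nat_less_iff)
  have j: "j = int r * i + int s" by (simp add: s i_def)
  define l where "l = (if s \<le> r div 2 then s else r - s)"
  have l: "l \<le> r div 2" using slt by (auto simp: l_def)
  have "cos (real k * (2 * pi * of_int j / real r)) = cos (2 * real l * pi / real r * real k)" for k :: nat
  proof (cases "s \<le> r div 2")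
    case True
    have "real k * (2 * pi * of_int j / real r)
        = 2 * real l * pi / real r * real k + (2 * pi) * of_int (i * int k)"
      using r True unfolding j l_def by (simp add: field_simps)
    then show ?thesis by (simp only: cos_add cos_int_2pin sin_int_2pin)
  next
    case False
    have "real k * (2 * pi * of_int j / real r)
        = - (2 * real l * pi / real r * real k) + (2 * pi) * of_int ((i + 1) * int k)"
      using r False slt unfolding j l_def by (simp add: field_simps of_nat_diff)
    then show ?thesis by (simp only: cos_add cos_int_2pin sin_int_2pin cos_minus)
  qed
  then show ?thesis using that l by blast
qed

lemma eventually_summable_tail_le:
  fixes g :: "nat \<Rightarrow> 'a::banach"
  assumes "summable (\<lambda>k. g (Suc k))" and "0 < e"
  shows "\<forall>\<^sub>F m in sequentially. \<forall>n. norm (\<Sum>k\<in>{m<..n}. g k) \<le> e"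
proof -
  obtain N where N: "\<And>m n. N \<le> m \<Longrightarrow> norm (\<Sum>k=m..<n. g (Suc k)) < e"
    using assms unfolding summable_Cauchy by blast
  have "(\<Sum>k\<in>{m<..n}. g k) = (\<Sum>k=m..<n. g (Suc k))" for m n
    by (rule sum.reindex_bij_witness[of _ Suc "\<lambda>k. k - 1"]) auto
  then show ?thesis using N unfolding eventually_sequentially by (metis less_imp_le)
qed

theorem theorem11:
  fixes p q c :: real and r :: nat and a :: "nat \<Rightarrow> complex"
  assumes "p > 1" and "q \<ge> 1" and "r \<ge> 1" and "c > 0"
    and "a \<in> GM_beta3 p q r"
    and "(\<lambda>n. real n * ln (real n) * norm (a n)) \<longlonglongrightarrow> 0"
    and "\<And>l::nat. l \<le> r div 2 \<Longrightarrow>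
           summable (\<lambda>k. a (Suc k) * of_real (cos (2 * real l * pi / real r * real (Suc k))))"
  shows "uniformly_convergent_on (UNIV :: real set)
           (\<lambda>N x. \<Sum>n=1..N. a n * of_real (cos (c * real n * x)))"
proof (rule Cauchy_uniformly_convergent, rule uniformly_Cauchy_onI')
  fix \<epsilon> :: real assume \<epsilon>: "0 < \<epsilon>"
  define K where "K = 2 / (1 - 2 powr (- (1 / p)))"
  have "2 powr (- (1 / p)) < 2 powr (0::real)" using assms(1) by (intro powr_less_mono) auto
  then have K: "0 \<le> K" by (simp add: K_def)
  define Q where "Q = 6 + ln p + (2 * K + 4)"
  have "0 \<le> ln p" using assms(1) by simp
  then have Q: "0 < Q" using K unfolding Q_def by linarith
  define e where "e = \<epsilon> / (2 * Q)"
  have e: "0 < e" using \<epsilon> Q by (simp add: e_def)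
  have lim: "(\<lambda>n. real n * norm (a n)) \<longlonglongrightarrow> 0"
  proof (rule Lim_null_comparison[OF _ assms(6)])
    show "\<forall>\<^sub>F n in sequentially. norm (real n * norm (a n)) \<le> real n * ln (real n) * norm (a n)"
      using eventually_ge_at_top[of 3]
    proof eventually_elim
      case (elim n)
      have "exp 1 \<le> real n" using exp_le elim by linarith
      then have "1 \<le> ln (real n)" using elim by (subst ln_ge_iff) auto
      then have "real n * norm (a n) * 1 \<le> real n * norm (a n) * ln (real n)"
        by (intro mult_left_mono) auto
      then show ?case by (simp add: mult_ac)
    qed
  qed
  have tails: "\<forall>\<^sub>F m in sequentially. \<forall>l\<in>{..r div 2}. \<forall>n.
      norm (\<Sum>k\<in>{m<..n}. a k * of_real (cos (2 * real l * pi / real r * real k))) \<le> e"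
    using assms(7) e by (intro eventually_ball_finite ballI eventually_summable_tail_le) auto
  have "\<forall>\<^sub>F m in sequentially. 2 \<le> m \<and> real m * norm (a m) \<le> e
      \<and> real m * ln (real m) * norm (a m) \<le> e
      \<and> (\<forall>n. (\<Sum>k=m..n. norm (Delta r a k)) \<le> K * e * real m powr (- (1 / p)))
      \<and> (\<forall>l\<in>{..r div 2}. \<forall>n.
          norm (\<Sum>k\<in>{m<..n}. a k * of_real (cos (2 * real l * pi / real r * real k))) \<le> e)"
    unfolding K_def
    by (intro eventually_conj tails eventually_ge_at_top
        eventually_mono[OF order_tendstoD(2)[OF lim e] less_imp_le]
        eventually_mono[OF order_tendstoD(2)[OF assms(6) e] less_imp_le]
        GM_beta3_sum_norm_Delta_bound[OF assms(1,2,5) lim e])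
  then obtain N where N: "\<And>m. N \<le> m \<Longrightarrow> 2 \<le> m \<and> real m * norm (a m) \<le> e
      \<and> real m * ln (real m) * norm (a m) \<le> e
      \<and> (\<forall>n. (\<Sum>k=m..n. norm (Delta r a k)) \<le> K * e * real m powr (- (1 / p)))
      \<and> (\<forall>l\<in>{..r div 2}. \<forall>n.
          norm (\<Sum>k\<in>{m<..n}. a k * of_real (cos (2 * real l * pi / real r * real k))) \<le> e)"
    unfolding eventually_sequentially by blast
  have tail: "norm (\<Sum>i\<in>{k<..l}. a i * of_real (cos (real i * (2 * pi * of_int j / real r)))) \<le> e"
    if "N \<le> k" for j :: int and k l
  proof -
    obtain h where "h \<le> r div 2"
      "\<And>i::nat. cos (real i * (2 * pi * of_int j / real r)) = cos (2 * real h * pi / real r * real i)"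
      using cos_rational_angle_reduce[OF assms(3)] by metis
    then show ?thesis using N[OF that] by simp
  qed
  have bound: "norm (\<Sum>k\<in>{m<..n}. a k * of_real (cos (real k * y))) \<le> Q * e"
    if "N \<le> m" "m \<le> n" for m n y
    unfolding Q_def using assms(1,3) e K N that tail
    by (intro norm_cos_sum_tail_le[where N = N and r = r]) auto
  show "\<exists>M. \<forall>x\<in>UNIV. \<forall>m\<ge>M. \<forall>n>m.
      dist (\<Sum>k=1..m. a k * of_real (cos (c * real k * x)))
        (\<Sum>k=1..n. a k * of_real (cos (c * real k * x))) < \<epsilon>"
  proof (intro exI[of _ N] ballI allI impI)
    fix x :: real and m n :: nat assume mn: "N \<le> m" "m < n"
    let ?f = "\<lambda>k. a k * of_real (cos (c * real k * x)) :: complex"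
    have eq: "{1..i} = {0<..i}" for i :: nat by auto
    have "(\<Sum>k=1..n. ?f k) = (\<Sum>k=1..m. ?f k) + (\<Sum>k\<in>{m<..n}. ?f k)"
      unfolding eq using mn by (intro sum_greaterThanAtMost_split) auto
    then have "dist (\<Sum>k=1..m. ?f k) (\<Sum>k=1..n. ?f k) = norm (\<Sum>k\<in>{m<..n}. ?f k)"
      by (simp add: dist_norm)
    also have "\<dots> = norm (\<Sum>k\<in>{m<..n}. a k * of_real (cos (real k * (c * x))))"
      by (simp add: mult_ac)
    also have "\<dots> \<le> Q * e" using bound mn by simp
    also have "\<dots> < \<epsilon>" using \<epsilon> Q by (simp add: e_def)
    finally show "dist (\<Sum>k=1..m. ?f k) (\<Sum>k=1..n. ?f k) < \<epsilon>" .
  qed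
qed

end
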